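(* Let $p=0$, let $q\ge 2$ be an integer, let $\tau\in\mathbb{C}$ satisfy $\tau^2+q=0$, let $w$ be an odd integer with $w\ge 3$, and let $\mathcal{D}$ be the minimal norm representatives digit set modulo $\tau^w$. Then there is an element of $\mathbb{Z}[\tau]$ whose $w$-NAF-expansion (base $\tau$, digit set $\mathcal{D}$) is non-optimal.
   Context: Voronoi cell: $V=\{z\in\mathbb{C}:\ |z|\le|z-y|\text{ for all }y\in\mathbb{Z}[\tau]\}$. Writing $\{x\}$ for the fractional part and $r=\{\mathrm{Re}\,\tau\}$, $t=\mathrm{Im}\,\tau$, its vertices, in cyclic order, are $v_0=\frac12+\frac{i}{2t}(t^2+r^2-r)$, $v_1=r-\frac12+\frac{i}{2t}(t^2-r^2+r)$, $v_2=v_0-1$, $v_3=-v_0$, $v_4=-v_1$, $v_5=-v_2$; if $\mathrm{Re}\,\tau\in\mathbb{Z}$ then $v_1=v_2$ and $v_4=v_5$ and $V$ is a rectangle. Let $m\in\{4,6\}$ be the number of distinct vertices and relabel the distinct vertices in this order as $v_0,\dots,v_{m-1}$ (indices modulo $m$); let $v_{k+1/2}$ be the midpoint of the segment from $v_k$ to $v_{k+1}$. The restricted Voronoi cell $\widetilde V$ consists of the interior of $V$, the open segments from $v_{k+1/2}$ to $v_{k+1}$ (both endpoints excluded) for all $k$, the points $v_{k+1/2}$ for $k\in\{0,\dots,\lfloor m/2\rfloor-1\}$, and the points $v_k$ for $k\in\{1,\dots,\lfloor m/3\rfloor\}$. Minimal norm representatives digit set modulo $\tau^w$: the set $\mathcal{D}\subseteq\mathbb{Z}[\tau]$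 consisting of $0$ and of exactly one representative of each residue class of $\mathbb{Z}[\tau]$ modulo $\tau^w$ that is not divisible by $\tau$, namely the one lying in $\tau^w\widetilde V$. A multi-expansion of $z\in\mathbb{Z}[\tau]$ is a finite multiset of pairs $(d,n)\in(\mathcal{D}\setminus\{0\})\times\mathbb{N}_0$ with $\sum d\,\tau^n=z$; its weight is its cardinality counted with multiplicity. An expansion is a multi-expansion in which the exponents $n$ are pairwise distinct, identified with a finitely supported sequence $(\eta_n)_{n\in\mathbb{N}_0}\in\mathcal{D}^{\mathbb{N}_0}$ with $\sum_n\eta_n\tau^n=z$. A $w$-NAF-expansion is an expansion such that every block of $w$ consecutive digits $\eta_{j+w-1}\ldots\eta_j$ contains at most one non-zero digit. With this digit set, every element of $\mathbb{Z}[\tau]$ has exactly one $w$-NAF-expansion (a known theorem). An expansion of $z$ is optimal if its weight is at most the weight of every multi-expansion of $z$; otherwise it is non-optimal. *)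

theory Defs
  imports
    "HOL-Analysis.Analysis"
    "HOL-Computational_Algebra.Polynomial"
    "HOL-Library.Multiset"
begin

definition int_adjoin :: "complex \<Rightarrow> complex set" where
  "int_adjoin \<tau> = range (\<lambda>p :: int poly. poly (map_poly of_int p) \<tau>)"

definition dvd_adjoin :: "complex \<Rightarrow> complex \<Rightarrow> complex \<Rightarrow> bool" where
  "dvd_adjoin \<tau> a b \<longleftrightarrow> (\<exists>c \<in> int_adjoin \<tau>. b = a * c)"

definition voronoi_cell :: "complex \<Rightarrow> complex set" where
  "voronoi_cell \<tau> = {z. \<forall>y \<in> int_adjoin \<tau>. norm z \<le> norm (z - y)}"

text \<open>
  For an imaginary quadratic integer \<open>\<tau>\<close>, the only possible coincidences are \<open>v\<^sub>1 = v\<^sub>2\<close> and \<open>v\<^sub>4 = v\<^sub>5\<close> (for \<open>Re \<tau> \<in> \<int>\<close>), so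
  \<^const>\<open>remdups\<close> respects the cyclic order and leaves \<open>v\<^sub>0\<close> in first position.
\<close>

definition voronoi_vertices :: "complex \<Rightarrow> complex list" where
  "voronoi_vertices \<tau> =
     (let r = frac (Re \<tau>); t = Im \<tau>;
          v0 = Complex (1/2) ((t^2 + r^2 - r) / (2 * t));
          v1 = Complex (r - 1/2) ((t^2 - r^2 + r) / (2 * t));
          v2 = v0 - 1
      in remdups [v0, v1, v2, - v0, - v1, - v2])"

definition voronoi_vertex :: "complex \<Rightarrow> nat \<Rightarrow> complex" where
  "voronoi_vertex \<tau> k = voronoi_vertices \<tau> ! (k mod length (voronoi_vertices \<tau>))"

definition voronoi_midpoint :: "complex \<Rightarrow> nat \<Rightarrow> complex" where
  "voronoi_midpoint \<tau> k = midpoint (voronoi_vertex \<tau> k) (voronoi_vertex \<tau> (k + 1))"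

definition restricted_voronoi_cell :: "complex \<Rightarrow> complex set" where
  "restricted_voronoi_cell \<tau> =
     (let m = length (voronoi_vertices \<tau>) in
        interior (voronoi_cell \<tau>)
        \<union> (\<Union>k<m. open_segment (voronoi_midpoint \<tau> k) (voronoi_vertex \<tau> (k + 1)))
        \<union> voronoi_midpoint \<tau> ` {..<m div 2}
        \<union> voronoi_vertex \<tau> ` {1..m div 3})"

text \<open>
  Divisibility of \<open>z\<close> by \<open>\<tau>\<close> depends only on the residue class of \<open>z\<close> modulo \<open>\<tau>\<^sup>w\<close> (for \<open>w \<ge> 1\<close>),
  so the last conjunct says that each admissible class has exactly one representative in
  \<open>D - {0}\<close>, and the third that there are no other digits and all lie in \<open>\<tau>\<^sup>w\<close> times the
  restricted cell.
\<close>

definition min_norm_digit_set :: "complex \<Rightarrow> nat \<Rightarrow> complex set \<Rightarrow> bool" where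
  "min_norm_digit_set \<tau> w D \<longleftrightarrow>
     D \<subseteq> int_adjoin \<tau> \<and> 0 \<in> D \<and>
     (\<forall>d \<in> D - {0}. \<not> dvd_adjoin \<tau> \<tau> d \<and> d \<in> (\<lambda>z. \<tau> ^ w * z) ` restricted_voronoi_cell \<tau>) \<and>
     (\<forall>z \<in> int_adjoin \<tau>. \<not> dvd_adjoin \<tau> \<tau> z \<longrightarrow> (\<exists>!d. d \<in> D - {0} \<and> dvd_adjoin \<tau> (\<tau> ^ w) (z - d)))"

definition multi_expansion :: "complex \<Rightarrow> complex set \<Rightarrow> complex \<Rightarrow> (complex \<times> nat) multiset \<Rightarrow> bool" where
  "multi_expansion \<tau> D z M \<longleftrightarrow>
     set_mset M \<subseteq> (D - {0}) \<times> UNIV \<and> (\<Sum>(d, n) \<in># M. d * \<tau> ^ n) = z"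

definition expansion :: "complex \<Rightarrow> complex set \<Rightarrow> complex \<Rightarrow> (nat \<Rightarrow> complex) \<Rightarrow> bool" where
  "expansion \<tau> D z \<eta> \<longleftrightarrow>
     finite {n. \<eta> n \<noteq> 0} \<and> range \<eta> \<subseteq> D \<and> (\<Sum>n | \<eta> n \<noteq> 0. \<eta> n * \<tau> ^ n) = z"

definition weight :: "(nat \<Rightarrow> complex) \<Rightarrow> nat" where
  "weight \<eta> = card {n. \<eta> n \<noteq> 0}"

definition w_NAF_expansion :: "complex \<Rightarrow> nat \<Rightarrow> complex set \<Rightarrow> complex \<Rightarrow> (nat \<Rightarrow> complex) \<Rightarrow> bool" where
  "w_NAF_expansion \<tau> w D z \<eta> \<longleftrightarrow>
     expansion \<tau> D z \<eta> \<and> (\<forall>j. card {i \<in> {j..<j + w}. \<eta> i \<noteq> 0} \<le> 1)"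

definition optimal :: "complex \<Rightarrow> complex set \<Rightarrow> complex \<Rightarrow> (nat \<Rightarrow> complex) \<Rightarrow> bool" where
  "optimal \<tau> D z \<eta> \<longleftrightarrow> (\<forall>M. multi_expansion \<tau> D z M \<longrightarrow> weight \<eta> \<le> size M)"

end

theory Submission
  imports Defs
begin

text \<open>
  Write \<open>w = 2k + 1\<close>, \<open>N = q\<^sup>k\<close> and \<open>s = (-1)\<^sup>k\<close>. As \<open>\<tau>\<close> is purely imaginary, everything is
  rectangular: \<open>\<int>[\<tau>] = \<int> + \<int>\<tau>\<close>, the Voronoi cell is an axis-parallel rectangle, and multiplication by
  \<open>\<tau>\<^sup>w = s N \<tau>\<close> turns it by a right angle. Hence \<open>a + b \<tau>\<close> is a non-zero digit as soon as \<open>q\<close> does not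
  divide \<open>a\<close>, \<open>2\<bar>a\<bar> < q N\<close>, and either \<open>2\<bar>b\<bar> < N\<close>, or \<open>2\<bar>b\<bar> = N\<close> and \<open>a\<close>, \<open>b\<close> have opposite signs
  (lemma \<open>lin_in_digit_set\<close>). So the real part of a digit may be about \<open>q\<close> times as large as its
  \<open>\<tau>\<close>-part.

  This asymmetry is what makes non-adjacent forms expensive. Let \<open>e\<close> be the largest integer with
  \<open>2e < q N\<close>. As \<open>\<tau>\<^bsup>w-1\<^esup> = s N\<close>, the digits \<open>e\<close> and \<open>s (e - \<tau>)\<close> at positions \<open>0\<close> and \<open>w - 1\<close> represent
  \<open>z = e + N (e - \<tau>)\<close>. These positions are too close for a \<open>w\<close>-NAF, so the two real parts have to be
  combined into one digit \<open>f \<equiv> e + N e\<close> modulo \<open>q N\<close>, and the carry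
  \<open>(z - f) / \<tau>\<^sup>w = - s - s (N - h) \<tau>\<close>, where \<open>h = \<lfloor>N/2\<rfloor>\<close>, turns the large real part into a large
  \<open>\<tau>\<close>-part. It just fails to be a digit: for odd \<open>N\<close> its \<open>\<tau>\<close>-part exceeds \<open>N/2\<close>, and for even \<open>N\<close> it
  lies on the half of the boundary that the restricted cell leaves out. It therefore
  needs the two digits of \<open>(- s + s h \<tau>) - \<tau>\<^sup>w\<close>, and the \<open>w\<close>-NAF
  \<open>z = f + (- s + s h \<tau>) \<tau>\<^sup>w - \<tau>\<^bsup>2w\<^esup>\<close> has weight \<open>3\<close> whereas a multi-expansion of weight \<open>2\<close> exists.
\<close>

section \<open>Arithmetic in the ring generated by an imaginary square root\<close>

locale imaginary_base =
  fixes q :: int and \<tau> :: complex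
  assumes q_ge_2: "q \<ge> 2" and base_sq: "\<tau>^2 + of_int q = 0"
begin

abbreviation lin :: "int \<Rightarrow> int \<Rightarrow> complex" where
  "lin a b \<equiv> of_int a + of_int b * \<tau>"

lemma Re_base: "Re \<tau> = 0" and Im_base_nz: "Im \<tau> \<noteq> 0"
proof -
  from base_sq have "Re (\<tau>^2 + of_int q) = 0" "Im (\<tau>^2 + of_int q) = 0" by simp_all
  hence re: "(Re \<tau>)^2 - (Im \<tau>)^2 + of_int q = 0" and im: "Re \<tau> * Im \<tau> = 0"
    by (auto simp: power2_eq_square)
  show nz: "Im \<tau> \<noteq> 0"
  proof
    assume "Im \<tau> = 0"
    with re have "(Re \<tau>)^2 = - of_int q" by simp
    moreover have "(Re \<tau>)^2 \<ge> 0" by simp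
    ultimately show False using q_ge_2 by linarith
  qed
  with im show "Re \<tau> = 0" by auto
qed

lemma base_mult_base: "\<tau> * \<tau> = - of_int q"
  using base_sq by (simp add: power2_eq_square add_eq_0_iff)

lemma lin_eq_iff: "lin a b = lin a' b' \<longleftrightarrow> a = a' \<and> b = b'"
  using Re_base Im_base_nz by (auto simp: complex_eq_iff)

lemma base_mult_lin: "\<tau> * lin a b = lin (- q * b) a"
proof -
  have "\<tau> * lin a b = of_int a * \<tau> + of_int b * (\<tau> * \<tau>)" by (simp add: algebra_simps)
  thus ?thesis by (simp add: base_mult_base)
qed

lemma lin_in_int_adjoin: "lin a b \<in> int_adjoin \<tau>"
  unfolding int_adjoin_def
  by (rule image_eqI[where x = "[:a, b:]"]) (simp_all add: map_poly_pCons mult.commute)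

lemma int_adjoin_eq: "int_adjoin \<tau> = {lin a b | a b. True}"
proof -
  have "\<exists>a b. poly (map_poly of_int p) \<tau> = lin a b" for p :: "int poly"
  proof (induction p)
    case 0
    show ?case by (intro exI[of _ 0]) simp
  next
    case (pCons c p)
    then obtain a b where "poly (map_poly of_int p) \<tau> = lin a b" by blast
    hence "poly (map_poly of_int (pCons c p)) \<tau> = lin (c - q * b) a"
      using pCons.hyps base_mult_lin[of a b] by (simp add: map_poly_pCons)
    thus ?case by blast
  qed
  thus ?thesis using lin_in_int_adjoin by (auto simp: int_adjoin_def)
qed

lemma base_dvd_lin_imp:
  assumes "dvd_adjoin \<tau> \<tau> (lin a b)"
  shows "q dvd a"
proof -
  from assms obtain c d where "lin a b = \<tau> * lin c d"
    unfolding dvd_adjoin_def int_adjoin_eq by blast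
  hence "a = - q * d" unfolding base_mult_lin lin_eq_iff by blast
  thus ?thesis by simp
qed

lemma even_power_base: "\<tau> ^ (2 * k) = of_int ((-1) ^ k * q ^ k)"
proof -
  have "\<tau> ^ (2 * k) = (\<tau> * \<tau>) ^ k" by (simp only: power_mult power2_eq_square)
  also have "\<dots> = of_int ((- 1 * q) ^ k)" by (simp add: base_mult_base)
  finally show ?thesis by (simp only: power_mult_distrib)
qed

lemma odd_power_base: "\<tau> ^ (2 * k + 1) = of_int ((-1) ^ k * q ^ k) * \<tau>"
  using even_power_base[of k] by simp

lemma odd_power_base_mult_lin:
  "\<tau> ^ (2 * k + 1) * lin a b = lin ((-1) ^ k * q ^ k * (- q * b)) ((-1) ^ k * q ^ k * a)"
proof -
  have "\<tau> ^ (2 * k + 1) * lin a b = of_int ((-1) ^ k * q ^ k) * (\<tau> * lin a b)"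
    unfolding odd_power_base by (simp only: mult.assoc)
  also have "\<dots> = of_int ((-1) ^ k * q ^ k) * lin (- q * b) a"
    by (simp only: base_mult_lin)
  also have "of_int c * lin x y = lin (c * x) (c * y)" for c x y
    by (simp add: algebra_simps)
  finally show ?thesis by (simp only: mult_ac)
qed

section \<open>The restricted Voronoi cell of a rectangular lattice\<close>

lemma voronoi_cell_bounds:
  assumes "z \<in> voronoi_cell \<tau>"
  shows "\<bar>Re z\<bar> \<le> 1/2" "\<bar>Im z\<bar> \<le> \<bar>Im \<tau>\<bar> / 2"
proof -
  have le: "(norm z)\<^sup>2 \<le> (norm (z - lin a b))\<^sup>2" for a b
    using assms lin_in_int_adjoin[of a b] by (auto simp: voronoi_cell_def power_mono)
  have sq: "(norm v)\<^sup>2 = (Re v)\<^sup>2 + (Im v)\<^sup>2" for v :: complex by (simp add: cmod_def)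
  show "\<bar>Re z\<bar> \<le> 1/2"
    using le[of 1 0] le[of "-1" 0] unfolding sq by (simp add: power2_eq_square algebra_simps)
  have "2 * (Im z * Im \<tau>) \<le> Im \<tau> * Im \<tau>" "- 2 * (Im z * Im \<tau>) \<le> Im \<tau> * Im \<tau>"
    using le[of 0 1] le[of 0 "-1"] Re_base unfolding sq
    by (simp_all add: power2_eq_square algebra_simps)
  hence "2 * \<bar>Im z\<bar> * \<bar>Im \<tau>\<bar> \<le> \<bar>Im \<tau>\<bar> * \<bar>Im \<tau>\<bar>"
    by (simp add: abs_mult[symmetric] abs_le_iff)
  thus "\<bar>Im z\<bar> \<le> \<bar>Im \<tau>\<bar> / 2"
    using Im_base_nz mult_le_cancel_right_pos[of "\<bar>Im \<tau>\<bar>" "2 * \<bar>Im z\<bar>" "\<bar>Im \<tau>\<bar>"] by simp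
qed

text \<open>An interior point stays in the cell when moved a little to either side, so the bound on the
  real part is strict there.\<close>
lemma interior_voronoi_cell_bound:
  assumes "z \<in> interior (voronoi_cell \<tau>)"
  shows "\<bar>Re z\<bar> < 1/2"
proof -
  from assms obtain e where e: "e > 0" "ball z e \<subseteq> voronoi_cell \<tau>"
    by (auto simp: mem_interior)
  have "z + of_real (e/2) \<in> ball z e" "z - of_real (e/2) \<in> ball z e"
    using e by (simp_all add: dist_norm norm_divide)
  hence "z + of_real (e/2) \<in> voronoi_cell \<tau>" "z - of_real (e/2) \<in> voronoi_cell \<tau>"
    using e by blast+
  hence "\<bar>Re z + e/2\<bar> \<le> 1/2" "\<bar>Re z - e/2\<bar> \<le> 1/2"
    by (auto dest: voronoi_cell_bounds(1))
  thus ?thesis using e by linarith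
qed

text \<open>Coordinates are written as multiples of \<open>Im \<tau>\<close>, even the zero ones below, so that boundary
  segments have a uniform shape in the coordinates with respect to \<open>1\<close> and \<open>\<tau>\<close>; this also covers
  both signs of \<open>Im \<tau>\<close> at once.\<close>
lemma voronoi_vertices_rectangle:
  "voronoi_vertices \<tau> =
     [Complex (1/2) (1/2 * Im \<tau>), Complex (-1/2) (1/2 * Im \<tau>),
      Complex (-1/2) (-1/2 * Im \<tau>), Complex (1/2) (-1/2 * Im \<tau>)]"
  using Im_base_nz
  by (simp add: voronoi_vertices_def Let_def Re_base power2_eq_square complex_eq_iff)

lemma restricted_cell_boundary_cases:
  assumes "z \<in> restricted_voronoi_cell \<tau>" "z \<notin> interior (voronoi_cell \<tau>)"
  shows "z \<in> open_segment (Complex 0 (1/2 * Im \<tau>)) (Complex (-1/2) (1/2 * Im \<tau>))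
    \<union> open_segment (Complex (-1/2) (0 * Im \<tau>)) (Complex (-1/2) (-1/2 * Im \<tau>))
    \<union> open_segment (Complex 0 (-1/2 * Im \<tau>)) (Complex (1/2) (-1/2 * Im \<tau>))
    \<union> open_segment (Complex (1/2) (0 * Im \<tau>)) (Complex (1/2) (1/2 * Im \<tau>))
    \<union> {Complex 0 (1/2 * Im \<tau>), Complex (-1/2) (0 * Im \<tau>), Complex (-1/2) (1/2 * Im \<tau>)}"
proof -
  have len: "length (voronoi_vertices \<tau>) = 4" by (simp add: voronoi_vertices_rectangle)
  have mid: "voronoi_midpoint \<tau> 0 = Complex 0 (1/2 * Im \<tau>)"
    "voronoi_midpoint \<tau> 1 = Complex (-1/2) (0 * Im \<tau>)"
    "voronoi_midpoint \<tau> 2 = Complex 0 (-1/2 * Im \<tau>)"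
    "voronoi_midpoint \<tau> 3 = Complex (1/2) (0 * Im \<tau>)"
    by (simp_all add: voronoi_midpoint_def voronoi_vertex_def voronoi_vertices_rectangle
        midpoint_def complex_eq_iff)
  have vert: "voronoi_vertex \<tau> 1 = Complex (-1/2) (1/2 * Im \<tau>)"
    "voronoi_vertex \<tau> 2 = Complex (-1/2) (-1/2 * Im \<tau>)"
    "voronoi_vertex \<tau> 3 = Complex (1/2) (-1/2 * Im \<tau>)"
    "voronoi_vertex \<tau> 4 = Complex (1/2) (1/2 * Im \<tau>)"
    by (simp_all add: voronoi_vertex_def voronoi_vertices_rectangle)
  have Un4: "(\<Union>i<4. A i) = A 0 \<union> A 1 \<union> A 2 \<union> A 3" for A :: "nat \<Rightarrow> complex set"
    by (simp add: numeral_eq_Suc lessThan_Suc Un_ac)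
  have img: "g ` {..<4 div 2} = {g 0, g 1}" "g ` {1..4 div 3} = {g 1}" for g :: "nat \<Rightarrow> complex"
  proof -
    have "{..<4 div 2} = {0, 1 :: nat}" "{1..4 div 3} = {1 :: nat}" by auto
    thus "g ` {..<4 div 2} = {g 0, g 1}" "g ` {1..4 div 3} = {g 1}" by simp_all
  qed
  have succ: "0 + 1 = (1::nat)" "1 + 1 = (2::nat)" "2 + 1 = (3::nat)" "3 + 1 = (4::nat)" by simp_all
  show ?thesis
    using assms unfolding restricted_voronoi_cell_def Let_def len Un4 img succ mid vert by blast
qed

text \<open>The two vertical sides are translates of each other, so the restricted cell keeps complementary
  halves of them: \<open>y > 0\<close> on the right side and \<open>y \<le> 0\<close> on the left one. The sign condition
  \<open>x y \<ge> 0\<close> holds on both halves; corners are exempt, since the one with \<open>x = -1/2\<close> and \<open>y = 1/2\<close> belongs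
  to the restricted cell.\<close>
lemma restricted_cell_bounds:
  assumes "z \<in> restricted_voronoi_cell \<tau>"
  obtains x y where "z = of_real x + of_real y * \<tau>" "\<bar>x\<bar> \<le> 1/2" "\<bar>y\<bar> \<le> 1/2"
    "\<bar>x\<bar> = 1/2 \<Longrightarrow> \<bar>y\<bar> < 1/2 \<Longrightarrow> x * y \<ge> 0"
proof -
  define y where "y = Im z / Im \<tau>"
  have zy: "z = of_real (Re z) + of_real y * \<tau>" and Imz: "Im z = y * Im \<tau>"
    using Im_base_nz Re_base by (simp_all add: y_def complex_eq_iff)
  have segment: "\<exists>u. 0 < u \<and> u < 1 \<and> Re z = a + u * (c - a) \<and> y = b + u * (d - b)"
    if seg: "z \<in> open_segment (Complex a (b * Im \<tau>)) (Complex c (d * Im \<tau>))" for a b c d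
  proof -
    from seg obtain u where u: "0 < u" "u < 1"
      "z = (1 - u) *\<^sub>R Complex a (b * Im \<tau>) + u *\<^sub>R Complex c (d * Im \<tau>)"
      by (auto simp: in_segment)
    from arg_cong[OF u(3), of Im] have "y * Im \<tau> = (b + u * (d - b)) * Im \<tau>"
      unfolding Imz[symmetric] by (simp add: algebra_simps)
    hence "y = b + u * (d - b)" using Im_base_nz by (simp only: mult_cancel_right) simp
    moreover from arg_cong[OF u(3), of Re] have "Re z = a + u * (c - a)"
      by (simp add: algebra_simps)
    ultimately show ?thesis using u by blast
  qed
  have "\<bar>Re z\<bar> \<le> 1/2 \<and> \<bar>y\<bar> \<le> 1/2 \<and> (\<bar>Re z\<bar> = 1/2 \<longrightarrow> \<bar>y\<bar> < 1/2 \<longrightarrow> Re z * y \<ge> 0)"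
  proof (cases "z \<in> interior (voronoi_cell \<tau>)")
    case True
    hence "z \<in> voronoi_cell \<tau>" using interior_subset by blast
    hence "\<bar>y\<bar> * \<bar>Im \<tau>\<bar> \<le> 1/2 * \<bar>Im \<tau>\<bar>"
      using voronoi_cell_bounds(2)[of z] by (simp add: Imz abs_mult)
    hence "\<bar>y\<bar> \<le> 1/2" using Im_base_nz by simp
    thus ?thesis using interior_voronoi_cell_bound[OF True] by auto
  next
    case False
    note restricted_cell_boundary_cases[OF assms False]
    then consider
        (top) "z \<in> open_segment (Complex 0 (1/2 * Im \<tau>)) (Complex (-1/2) (1/2 * Im \<tau>))"
      | (left) "z \<in> open_segment (Complex (-1/2) (0 * Im \<tau>)) (Complex (-1/2) (-1/2 * Im \<tau>))"
      | (bottom) "z \<in> open_segment (Complex 0 (-1/2 * Im \<tau>)) (Complex (1/2) (-1/2 * Im \<tau>))"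
      | (right) "z \<in> open_segment (Complex (1/2) (0 * Im \<tau>)) (Complex (1/2) (1/2 * Im \<tau>))"
      | (points) "z = Complex 0 (1/2 * Im \<tau>) \<or> z = Complex (-1/2) (0 * Im \<tau>)
          \<or> z = Complex (-1/2) (1/2 * Im \<tau>)"
      by blast
    thus ?thesis
    proof cases
      case top from segment[OF this] show ?thesis by auto
    next
      case left from segment[OF this] show ?thesis by auto
    next
      case bottom from segment[OF this] show ?thesis by auto
    next
      case right from segment[OF this] show ?thesis by auto
    next
      case points thus ?thesis using Im_base_nz by (auto simp: y_def)
    qed
  qed
  with zy that show thesis by blast
qed

section \<open>Explicit digits\<close>

text \<open>The factor \<open>\<tau>\<^sup>w = s q\<^sup>k \<tau>\<close> maps \<open>x + y \<tau>\<close> to \<open>- s q\<^bsup>k+1\<^esup> y + s q\<^sup>k x \<tau>\<close>, which swaps the two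
  coordinates and reverses the sign of their product; the sign \<open>s\<close> cancels from the product.\<close>
lemma digit_bounds:
  assumes D: "min_norm_digit_set \<tau> (2 * k + 1) D" and d: "d \<in> D - {0}"
  obtains a b where "d = lin a b" "2 * \<bar>a\<bar> \<le> q * q ^ k" "2 * \<bar>b\<bar> \<le> q ^ k"
    "2 * \<bar>b\<bar> = q ^ k \<Longrightarrow> 2 * \<bar>a\<bar> < q * q ^ k \<Longrightarrow> a * b \<le> 0"
proof -
  define N where "N = q ^ k"
  define s :: int where "s = (-1) ^ k"
  have N: "N > 0" using q_ge_2 by (simp add: N_def)
  have s: "s = 1 \<or> s = -1" unfolding s_def by (cases "even k") auto
  from D d obtain a b where dab: "d = lin a b"
    unfolding min_norm_digit_set_def int_adjoin_eq by blast
  from D d obtain v where v: "v \<in> restricted_voronoi_cell \<tau>" "d = \<tau> ^ (2 * k + 1) * v"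
    unfolding min_norm_digit_set_def by blast
  from restricted_cell_bounds[OF v(1)] obtain x y where xy: "v = of_real x + of_real y * \<tau>"
    "\<bar>x\<bar> \<le> 1/2" "\<bar>y\<bar> \<le> 1/2" "\<bar>x\<bar> = 1/2 \<Longrightarrow> \<bar>y\<bar> < 1/2 \<Longrightarrow> x * y \<ge> 0" by blast
  have "lin a b = of_int (s * N) * (of_real x * \<tau> + of_real y * (\<tau> * \<tau>))"
    using v(2) dab unfolding xy(1) odd_power_base s_def N_def by (simp add: algebra_simps)
  hence eq: "lin a b = of_real (s * N * x) * \<tau> + of_real (- (s * N * q * y))"
    by (simp add: base_mult_base algebra_simps)
  from arg_cong[OF eq, of Re] arg_cong[OF eq, of Im]
  have a: "of_int a = - (s * N * q * y)" and b: "of_int b = s * N * x"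
    using Re_base Im_base_nz by (simp_all add: algebra_simps)
  have abs_a: "of_int \<bar>a\<bar> = of_int (q * N) * \<bar>y\<bar>" and abs_b: "of_int \<bar>b\<bar> = of_int N * \<bar>x\<bar>"
    using s N q_ge_2 by (auto simp: a b abs_mult)
  have qN: "q * N > 0" using N q_ge_2 by simp
  have "real_of_int (2 * \<bar>a\<bar>) \<le> of_int (q * N)"
  proof -
    have "0 \<le> real_of_int (q * N)" using qN by linarith
    from mult_left_mono[OF xy(3) this] show ?thesis using abs_a by linarith
  qed
  hence 1: "2 * \<bar>a\<bar> \<le> q * N" by linarith
  have "real_of_int (2 * \<bar>b\<bar>) \<le> of_int N"
    using mult_left_mono[OF xy(2), of "of_int N"] N abs_b by simp
  hence 2: "2 * \<bar>b\<bar> \<le> N" by linarith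
  have 3: "a * b \<le> 0" if bN: "2 * \<bar>b\<bar> = N" and aN: "2 * \<bar>a\<bar> < q * N"
  proof -
    have "of_int N * (2 * \<bar>x\<bar>) = real_of_int N * 1"
      using bN abs_b by linarith
    hence x: "\<bar>x\<bar> = 1/2" using N by simp
    have "of_int (q * N) * (2 * \<bar>y\<bar>) < real_of_int (q * N) * 1"
      using aN abs_a by linarith
    hence y: "\<bar>y\<bar> < 1/2" using qN by (simp only: mult_less_cancel_left_pos of_int_0_less_iff)
    have "real_of_int (a * b) = - (of_int (s * s) * of_int (N * N * q) * (x * y))"
      by (simp add: a b algebra_simps)
    also have "\<dots> = - (of_int (N * N * q) * (x * y))" using s by auto
    also have "\<dots> \<le> 0" using xy(4)[OF x y] N q_ge_2 by (simp add: zero_le_mult_iff)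
    finally show ?thesis by linarith
  qed
  show thesis
    by (rule that[OF dab]) (use 1 2 3 in \<open>simp_all add: N_def\<close>)
qed

text \<open>The digit \<open>d\<close> congruent to \<open>a + b \<tau>\<close> modulo \<open>\<tau>\<^sup>w\<close> differs from it by multiples of \<open>q\<^bsup>k+1\<^esup>\<close> and
  \<open>q\<^sup>k\<close> in the two coordinates, and both lie in the same closed box with these side lengths, \<open>a\<close> not
  being at the end of its range. So the two agree, except that the \<open>\<tau>\<close>-parts could be opposite boundary values; the sign conditions
  exclude this.\<close>
lemma lin_in_digit_set:
  assumes D: "min_norm_digit_set \<tau> (2 * k + 1) D"
    and a: "\<not> q dvd a" "2 * \<bar>a\<bar> < q * q ^ k"
    and b: "2 * \<bar>b\<bar> \<le> q ^ k" "2 * \<bar>b\<bar> = q ^ k \<Longrightarrow> a * b < 0"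
  shows "lin a b \<in> D - {0}"
proof -
  define N where "N = q ^ k"
  define s :: int where "s = (-1) ^ k"
  have N: "N > 0" and qN: "q * N > 0" using q_ge_2 by (simp_all add: N_def)
  from D a(1) obtain d where d: "d \<in> D - {0}" "dvd_adjoin \<tau> (\<tau> ^ (2 * k + 1)) (lin a b - d)"
    unfolding min_norm_digit_set_def using lin_in_int_adjoin base_dvd_lin_imp by blast
  from digit_bounds[OF D d(1)] obtain a' b' where d': "d = lin a' b'" "2 * \<bar>a'\<bar> \<le> q * N"
    "2 * \<bar>b'\<bar> \<le> N" "2 * \<bar>b'\<bar> = N \<Longrightarrow> 2 * \<bar>a'\<bar> < q * N \<Longrightarrow> a' * b' \<le> 0"
    unfolding N_def by blast
  from d(2) obtain c e where "lin a b - d = \<tau> ^ (2 * k + 1) * lin c e"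
    unfolding dvd_adjoin_def int_adjoin_eq by blast
  also have "\<dots> = lin (- (s * e) * (q * N)) (s * c * N)"
    unfolding odd_power_base_mult_lin s_def[symmetric] N_def[symmetric]
    by (simp add: algebra_simps)
  also have "lin a b - d = lin (a - a') (b - b')" by (simp add: d'(1) algebra_simps)
  finally have diff: "a - a' = - (s * e) * (q * N)" "b - b' = s * c * N"
    unfolding lin_eq_iff by auto
  have small: "m = 0" if "\<bar>m * n\<bar> < n" for m n :: int
  proof (rule ccontr)
    assume "m \<noteq> 0"
    hence "1 * \<bar>n\<bar> \<le> \<bar>m\<bar> * \<bar>n\<bar>" by (intro mult_right_mono) auto
    with that show False by (simp add: abs_mult)
  qed
  have "\<bar>a - a'\<bar> < q * N" using a(2) d'(2) by (simp add: N_def)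
  hence "- (s * e) = 0" unfolding diff(1) by (rule small)
  hence "a = a'" using diff(1) unfolding \<open>- (s * e) = 0\<close> by simp
  moreover have "b = b'"
  proof (rule ccontr)
    assume ne: "b \<noteq> b'"
    have "\<bar>b - b'\<bar> \<ge> N"
    proof (rule ccontr)
      assume "\<not> \<bar>b - b'\<bar> \<ge> N"
      hence "\<bar>s * c * N\<bar> < N" unfolding diff(2) by simp
      hence "s * c = 0" by (rule small)
      hence "b - b' = 0" unfolding diff(2) by simp
      with ne show False by simp
    qed
    hence "2 * \<bar>b\<bar> = N" "2 * \<bar>b'\<bar> = N" "b' = - b" using b(1) d'(3) ne by (auto simp: N_def)
    hence "a * b < 0" "a * - b \<le> 0"
      using b(2) d'(4) \<open>a = a'\<close> a(2) by (auto simp: N_def)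
    thus False by simp
  qed
  ultimately show ?thesis using d(1) d'(1) by simp
qed

section \<open>A non-optimal non-adjacent form\<close>

lemma ex_nonoptimal_NAF:
  assumes D: "min_norm_digit_set \<tau> (2 * k + 1) D" and k: "k \<ge> 1"
  shows "\<exists>z \<in> int_adjoin \<tau>. \<exists>\<eta>. w_NAF_expansion \<tau> (2 * k + 1) D z \<eta> \<and> \<not> optimal \<tau> D z \<eta>"
proof -
  define N where "N = q ^ k"
  define s :: int where "s = (-1) ^ k"
  define w where "w = 2 * k + 1"
  define e where "e = (q * N - 1) div 2"
  define h where "h = N div 2"
  define f where "f = e + N * e - (N - h) * (q * N)"
  have q_dvd_N: "q dvd N" using k by (simp add: N_def dvd_power)
  have "N > 0" using q_ge_2 by (simp add: N_def)
  with q_dvd_N have "q \<le> N" by (simp add: zdvd_imp_le)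
  with q_ge_2 have N2: "N \<ge> 2" by simp
  have "2 * N \<le> q * N" using q_ge_2 N2 by (intro mult_right_mono) auto
  with N2 have qN: "q * N \<ge> 2 * N" "q * N \<ge> 4" by linarith+
  have e_pos: "e > 0" and e_bound: "2 * e < q * N" using qN(2) unfolding e_def by linarith+
  have s: "s = 1 \<or> s = -1" unfolding s_def by (cases "even k") auto
  have q_one: "\<not> q dvd 1" using q_ge_2 by (auto dest: zdvd_imp_le)
  \<comment> \<open>\<open>f\<close> equals \<open>e - N\<close> for even \<open>N\<close> and \<open>- (N + 1) / 2\<close> for odd \<open>N\<close>;
    both are small enough for the real part of a digit.\<close>
  have e_f: "\<not> q dvd e \<and> 2 * \<bar>f\<bar> < q * N"
  proof (cases "even N")
    case True
    then obtain M where M: "N = 2 * M" by (auto elim: evenE)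
    have e: "e = q * M - 1" unfolding e_def M by auto
    have f: "f = q * M - 1 - 2 * M" unfolding f_def h_def e M by (simp add: algebra_simps)
    have "\<not> q dvd e"
    proof
      assume "q dvd e"
      hence "q dvd q * M - e" by simp
      thus False using q_one by (simp add: e)
    qed
    moreover have "2 * M \<le> q * M" "M \<ge> 1" using qN N2 unfolding M by auto
    hence "\<bar>f\<bar> < q * M" unfolding f by linarith
    ultimately show ?thesis unfolding M by simp
  next
    case False
    hence "odd q" using k by (auto simp: N_def)
    with False have "odd (q * N)" by simp
    then obtain K where K: "q * N = 2 * K + 1" by (elim oddE)
    from False obtain M where M: "N = 2 * M + 1" by (auto elim: oddE)
    have e: "e = K" unfolding e_def K by simp
    have h: "h = M" unfolding h_def M by simp
    have f: "f = - M - 1" unfolding f_def K e h by (simp add: M algebra_simps)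
    have "\<not> q dvd e"
    proof
      assume "q dvd e"
      hence "q dvd q * N - 2 * e" by simp
      hence "q dvd 1" unfolding e K by simp
      thus False using q_one by simp
    qed
    moreover have "2 * \<bar>f\<bar> = N + 1" using N2 unfolding f M by arith
    hence "2 * \<bar>f\<bar> < q * N" using qN N2 by linarith
    ultimately show ?thesis by simp
  qed
  have f_coprime: "\<not> q dvd f"
  proof
    assume "q dvd f"
    hence "q dvd f - (N * e - (N - h) * (q * N))" using q_dvd_N by (intro dvd_diff) simp_all
    thus False using e_f by (simp add: f_def)
  qed
  have h: "2 * h \<le> N" "h > 0" using N2 by (auto simp: h_def)
  note digit = lin_in_digit_set[OF D, folded N_def]
  \<comment> \<open>The digit \<open>s e - s \<tau>\<close> lies on the boundary if \<open>N = 2\<close>, and \<open>- s + s h \<tau>\<close> does if \<open>N\<close> is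
    even; in both cases the two coordinates have opposite signs, as required.\<close>
  have d1: "lin e 0 \<in> D - {0}"
    using e_f e_bound e_pos N2 by (intro digit) auto
  have d2: "lin (s * e) (- s) \<in> D - {0}"
    using s e_f e_bound e_pos N2 by (intro digit) auto
  have n0: "lin f 0 \<in> D - {0}"
    using e_f f_coprime N2 by (intro digit) auto
  have n1: "lin (- s) (s * h) \<in> D - {0}"
    using s h q_one qN N2 by (intro digit) auto
  have n2: "lin (- 1) 0 \<in> D - {0}"
    using q_one qN N2 by (intro digit) auto
  note shift = odd_power_base_mult_lin[of k, folded w_def s_def N_def]
  have w: "w \<ge> 3" using k by (simp add: w_def)
  have ss: "s * s = 1" using s by auto

  define z where "z = lin (e + N * e) (- N)"
  define a where "a = lin e 0"
  define b where "b = lin (s * e) (- s)"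
  have ab: "a \<in> D" "a \<noteq> 0" "b \<in> D" "b \<noteq> 0"
    using d1 d2 unfolding a_def b_def by blast+
  define M where "M = {#(a, 0 :: nat), (b, 2 * k)#}"
  have "b * \<tau> ^ (2 * k) = of_int (s * N) * lin (s * e) (- s)"
    unfolding b_def even_power_base s_def[symmetric] N_def[symmetric] by (simp only: mult.commute)
  also have "\<dots> = lin (s * s * N * e) (- (s * s * N))" by (simp add: algebra_simps)
  finally have "a + b * \<tau> ^ (2 * k) = z" unfolding ss a_def z_def by (simp add: algebra_simps)
  hence "multi_expansion \<tau> D z M"
    using ab by (simp add: multi_expansion_def M_def)
  moreover have "size M = 2" by (simp add: M_def)
  ultimately have short: "\<exists>M. multi_expansion \<tau> D z M \<and> size M = 2" by blast

  define x0 where "x0 = lin f 0"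
  define x1 where "x1 = lin (- s) (s * h)"
  define x2 where "x2 = lin (- 1) 0"
  have x: "x0 \<in> D" "x0 \<noteq> 0" "x1 \<in> D" "x1 \<noteq> 0" "x2 \<in> D" "x2 \<noteq> 0"
    using n0 n1 n2 unfolding x0_def x1_def x2_def by blast+
  define \<eta> where "\<eta> = (\<lambda>n. 0)(0 := x0, w := x1, 2 * w := x2)"
  have supp: "{n. \<eta> n \<noteq> 0} = {0, w, 2 * w}"
    using x w by (auto simp: \<eta>_def)
  have "weight \<eta> = 3" using w by (simp add: weight_def supp)
  with short have "\<not> optimal \<tau> D z \<eta>" unfolding optimal_def by force
  moreover have "w_NAF_expansion \<tau> w D z \<eta>"
  proof -
    have "\<tau> ^ (2 * w) = \<tau> ^ w * (\<tau> ^ w * lin 1 0)" by (simp add: mult_2 power_add)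
    also have "\<dots> = lin (- (s * s) * (q * N * N)) 0" unfolding shift by (simp add: algebra_simps)
    finally have w2: "\<tau> ^ (2 * w) = lin (- (q * N * N)) 0" unfolding ss by simp
    have "(\<Sum>n | \<eta> n \<noteq> 0. \<eta> n * \<tau> ^ n) = x0 + \<tau> ^ w * x1 + \<tau> ^ (2 * w) * x2"
      unfolding supp using w by (simp add: \<eta>_def mult.commute)
    also have "\<dots> = lin (f - s * s * (q * N * h) + q * N * N) (- (s * s) * N)"
      unfolding x0_def x1_def x2_def shift w2 by (simp add: algebra_simps)
    also have "f - s * s * (q * N * h) + q * N * N = e + N * e"
      unfolding ss f_def by (simp add: algebra_simps)
    also have "- (s * s) * N = - N" unfolding ss by simp
    finally have "(\<Sum>n | \<eta> n \<noteq> 0. \<eta> n * \<tau> ^ n) = z" unfolding z_def .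
    moreover have "0 \<in> D" using D unfolding min_norm_digit_set_def by blast
    hence "\<eta> n \<in> D" for n using x by (simp add: \<eta>_def)
    hence "range \<eta> \<subseteq> D" by blast
    moreover have "finite {n. \<eta> n \<noteq> 0}" unfolding supp by simp
    ultimately have "expansion \<tau> D z \<eta>" unfolding expansion_def by blast
    moreover have "card {i \<in> {j..<j + w}. \<eta> i \<noteq> 0} \<le> 1" for j
    proof -
      have block: "{i \<in> {j..<j + w}. \<eta> i \<noteq> 0} = {j..<j + w} \<inter> {0, w, 2 * w}"
        unfolding supp[symmetric] by blast
      consider "j = 0" | "0 < j" "j \<le> w" | "w < j" by linarith
      then have "\<exists>n. {j..<j + w} \<inter> {0, w, 2 * w} \<subseteq> {n}"
      proof cases
        case 1
        thus ?thesis by (intro exI[of _ 0]) auto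
      next
        case 2
        thus ?thesis by (intro exI[of _ w]) auto
      next
        case 3
        thus ?thesis by (intro exI[of _ "2 * w"]) auto
      qed
      then obtain n where "{j..<j + w} \<inter> {0, w, 2 * w} \<subseteq> {n}" by blast
      hence "card ({j..<j + w} \<inter> {0, w, 2 * w}) \<le> card {n}" by (intro card_mono) simp_all
      thus ?thesis unfolding block by simp
    qed
    ultimately show ?thesis unfolding w_NAF_expansion_def by blast
  qed
  moreover have "z \<in> int_adjoin \<tau>" unfolding z_def by (rule lin_in_int_adjoin)
  ultimately show ?thesis unfolding w_def by blast
qed

end

theorem proposition10p1:
  fixes q :: int and \<tau> :: complex and w :: nat and D :: "complex set"
  assumes "q \<ge> 2"
    and "\<tau>^2 + of_int q = 0"
    and "odd w" and "w \<ge> 3"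
    and "min_norm_digit_set \<tau> w D"
  shows "\<exists>z \<in> int_adjoin \<tau>. \<exists>\<eta>. w_NAF_expansion \<tau> w D z \<eta> \<and> \<not> optimal \<tau> D z \<eta>"
proof -
  interpret imaginary_base q \<tau> by unfold_locales fact+
  from \<open>odd w\<close> obtain k where k: "w = 2 * k + 1" by (elim oddE)
  with \<open>w \<ge> 3\<close> have "k \<ge> 1" by simp
  from ex_nonoptimal_NAF[OF assms(5)[unfolded k] this] show ?thesis unfolding k .
qed

end
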